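(* Let $D$ be a defining set for the full design $F(v,3)$. Then $$|D|\geq \frac{v(v-1)\left(v-\frac52-\sqrt{(32v-85)/12}\right)}{6}=\binom{v}{3}\left(1-O(v^{-1/2})\right).$$
   Context: $N(v)=\{1,\dots,v\}$. A $(v,k,\lambda)$-design is a collection (repeated blocks allowed) of $k$-element subsets (blocks) of $N(v)$ such that each unordered pair of distinct elements of $N(v)$ lies in exactly $\lambda$ blocks. The full design $F(v,k)$ consists of all $k$-subsets of $N(v)$, each once. A subset $D\subseteq F(v,k)$ is a defining set for $F(v,k)$ if $F(v,k)$ is the only $(v,k,\binom{v-2}{k-2})$-design (repeated blocks allowed) containing $D$. $|D|$ is the number of blocks in $D$. *)

theory Defs
  imports Complex_Main "HOL-Library.Multiset" "HOL-Library.Landau_Symbols"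
begin

text \<open>
  Blocks of a design may be repeated, so a design is a multiset of blocks, and
  the number of blocks containing a pair is counted with multiplicity.
\<close>

definition is_design :: "nat \<Rightarrow> nat \<Rightarrow> nat \<Rightarrow> nat set multiset \<Rightarrow> bool" where
  "is_design v k l B \<longleftrightarrow>
     (\<forall>b\<in>#B. b \<subseteq> {1..v} \<and> card b = k) \<and>
     (\<forall>x\<in>{1..v}. \<forall>y\<in>{1..v}. x \<noteq> y \<longrightarrow> size {#b \<in># B. x \<in> b \<and> y \<in> b#} = l)"

definition full_design :: "nat \<Rightarrow> nat \<Rightarrow> nat set set" where
  "full_design v k = {b. b \<subseteq> {1..v} \<and> card b = k}"

text \<open>
  The subtractions are truncated, so this is the intended notion only for
  \<open>2 \<le> k \<le> v\<close>.
\<close>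

definition defining_set :: "nat \<Rightarrow> nat \<Rightarrow> nat set set \<Rightarrow> bool" where
  "defining_set v k D \<longleftrightarrow>
     D \<subseteq> full_design v k \<and>
     {B. is_design v k ((v - 2) choose (k - 2)) B \<and> mset_set D \<subseteq># B}
       = {mset_set (full_design v k)}"

end

theory Submission
  imports Defs "HOL-Real_Asymp.Real_Asymp" "HOL-Analysis.Convex"
begin

text \<open>
  Let \<open>U\<close> be the complement of \<open>D\<close> and let \<open>G\<close> be the common part of the link graphs in \<open>U\<close> of
  two points \<open>x\<close> and \<open>y\<close>. A nonzero \<open>{-1, 0, 1}\<close>-weighting of the edges of \<open>G\<close> with zero sum at every
  vertex yields a trade inside \<open>U\<close>: replace \<open>xe\<close> by \<open>ye\<close> on positive edges and \<open>ye\<close> by \<open>xe\<close> on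
  negative ones. Even cycles, and pairs of odd cycles meeting in a vertex, carry such weightings;
  so relative to a spanning forest all fundamental cycles of \<open>G\<close> are vertex-disjoint, of length at
  least 3, and \<open>G\<close>, having \<open>v - 2\<close> vertices, has at most \<open>4 (v - 2) / 3 - 1\<close> edges. Summing over
  all \<open>x\<close> and \<open>y\<close> bounds the second moment of the pair degrees of \<open>U\<close>, and Cauchy-Schwarz then bounds
  the size of \<open>U\<close>.
\<close>

section \<open>Edge weightings with prescribed vertex sums\<close>

definition vertex_sum :: "'a set set \<Rightarrow> ('a set \<Rightarrow> int) \<Rightarrow> 'a \<Rightarrow> int" where
  "vertex_sum E f w = (\<Sum>e\<in>E. if w \<in> e then f e else 0)"

text \<open>Weights stay within \<open>{-1, 0, 1}\<close> because each block of the full design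
  occurs once and so can be traded away at most once.\<close>

definition balanced_free :: "'a set set \<Rightarrow> bool" where
  "balanced_free E \<longleftrightarrow>
     (\<forall>f. (\<forall>e\<in>E. f e \<in> {-1, 0, 1}) \<longrightarrow> (\<forall>w. vertex_sum E f w = 0) \<longrightarrow> (\<forall>e\<in>E. f e = 0))"

lemma vertex_sum_add: "vertex_sum E (\<lambda>e. f e + g e) w = vertex_sum E f w + vertex_sum E g w"
  by (simp add: vertex_sum_def flip: sum.distrib cong: sum.cong if_cong) (rule sum.cong, auto)

lemma vertex_sum_diff: "vertex_sum E (\<lambda>e. f e - g e) w = vertex_sum E f w - vertex_sum E g w"
  by (simp add: vertex_sum_def flip: sum_subtractf cong: sum.cong if_cong) (rule sum.cong, auto)

lemma vertex_sum_single:
  assumes "finite E" "e0 \<in> E"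
  shows "vertex_sum E (\<lambda>e. if e = e0 then c else 0) w = (if w \<in> e0 then c else 0)"
proof -
  have "vertex_sum E (\<lambda>e. if e = e0 then c else 0) w
      = (\<Sum>e\<in>E. if e = e0 then (if w \<in> e0 then c else 0) else 0)"
    unfolding vertex_sum_def by (rule sum.cong) auto
  then show ?thesis using assms by simp
qed

section \<open>Rooted spanning forests and ancestors\<close>

text \<open>The maps are total on the type, so a vertex on no edge is a root of depth 0.
  \<open>root_edge\<close> makes the forest spanning: both ends of any edge, even outside the
  forest, lie in the same tree.\<close>

locale rooted_forest =
  fixes E :: "'a set set" and parent root :: "'a \<Rightarrow> 'a" and depth :: "'a \<Rightarrow> nat"
  assumes finite_E: "finite E"
    and depth_parent: "0 < depth v \<Longrightarrow> depth v = Suc (depth (parent v))"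
    and parent_edge: "0 < depth v \<Longrightarrow> {v, parent v} \<in> E"
    and root_parent: "0 < depth v \<Longrightarrow> root (parent v) = root v"
    and root_depth0: "depth v = 0 \<Longrightarrow> root v = v"
    and root_edge: "{a, b} \<in> E \<Longrightarrow> root a = root b"
begin

text \<open>The bound \<open>depth u\<close> stops the iteration at the root, whose
  \<open>parent\<close> is unspecified.\<close>

definition anc :: "'a \<Rightarrow> 'a set" where
  "anc u = (\<lambda>i. (parent ^^ i) u) ` {..depth u}"

lemma anc_root: "depth u = 0 \<Longrightarrow> anc u = {u}"
  by (simp add: anc_def)

lemma anc_parent:
  assumes "0 < depth u"
  shows "anc u = insert u (anc (parent u))"
proof -
  have "anc u = (\<lambda>i. (parent ^^ i) u) ` insert 0 (Suc ` {..depth (parent u)})"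
    using depth_parent[OF assms] by (simp add: anc_def atMost_Suc_eq_insert_0)
  also have "\<dots> = insert u (anc (parent u))"
    by (simp add: anc_def image_image funpow_Suc_right del: funpow.simps)
  finally show ?thesis .
qed

lemma finite_anc: "finite (anc u)"
  by (simp add: anc_def)

lemma self_in_anc: "u \<in> anc u"
  by (force simp: anc_def)

lemma depth_root: "depth (root u) = 0"
proof (induction "depth u" arbitrary: u)
  case 0
  then show ?case by (simp add: root_depth0)
next
  case (Suc k)
  then have "depth (root (parent u)) = 0" using depth_parent[of u] by simp
  then show ?case using Suc.hyps(2) root_parent[of u] by simp
qed

lemma depth_anc: "v \<in> anc u \<Longrightarrow> v = u \<or> depth v < depth u"
proof (induction "depth u" arbitrary: u)
  case 0
  then show ?case by (simp add: anc_root)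
next
  case (Suc k)
  then show ?case using depth_parent[of u] anc_parent[of u] by fastforce
qed

lemma root_in_anc: "root u \<in> anc u"
proof (induction "depth u" arbitrary: u)
  case 0
  then show ?case by (simp add: anc_root root_depth0)
next
  case (Suc k)
  then show ?case using depth_parent[of u] anc_parent[of u] root_parent[of u] by fastforce
qed

lemma root_anc: "v \<in> anc u \<Longrightarrow> depth v = 0 \<Longrightarrow> v = root u"
proof (induction "depth u" arbitrary: u)
  case 0
  then show ?case by (simp add: anc_root root_depth0)
next
  case (Suc k)
  then show ?case using depth_parent[of u] anc_parent[of u] root_parent[of u] by fastforce
qed

lemma not_in_anc_parent: "0 < depth u \<Longrightarrow> u \<notin> anc (parent u)"
  using depth_anc[of u "parent u"] depth_parent[of u] by force

definition tree_edges :: "'a set set" where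
  "tree_edges = (\<lambda>v. {v, parent v}) ` {v. 0 < depth v}"

text \<open>Otherwise \<open>u\<close> and \<open>v\<close> would be each other's parents, against
  the depths. Tree edges are thus indexed by their lower ends.\<close>

lemma tree_edge_inj:
  assumes "0 < depth v" "0 < depth u" "{v, parent v} = {u, parent u}"
  shows "v = u"
  using assms depth_parent[of v] depth_parent[of u] by (auto simp: doubleton_eq_iff)

section \<open>Alternating path weightings and fundamental cycles\<close>

definition sgn_at :: "'a \<Rightarrow> int" where "sgn_at v = (-1) ^ depth v"

text \<open>Path from \<open>u\<close> to its root; the alternating signs make the sums at inner vertices cancel.\<close>

definition flow :: "'a \<Rightarrow> 'a set \<Rightarrow> int" where
  "flow u e = (\<Sum>v\<in>anc u. if 0 < depth v \<and> {v, parent v} = e then sgn_at v else 0)"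

lemma flow_root: "depth u = 0 \<Longrightarrow> flow u e = 0"
  by (simp add: flow_def anc_root)

lemma flow_parent:
  assumes "0 < depth u"
  shows "flow u e = (if e = {u, parent u} then sgn_at u else 0) + flow (parent u) e"
  using assms not_in_anc_parent[OF assms] finite_anc
  by (auto simp: flow_def anc_parent)

text \<open>Signs change with depth, so consecutive path edges cancel at the vertex between them.
  The top edge has its lower end at depth 1, so the defect at the root is -1 regardless of
  \<open>u\<close>; flows within one tree can therefore be combined to remove it. For a root
  \<open>u\<close> the two terms cancel, matching the empty path.\<close>

lemma vertex_sum_flow:
  "vertex_sum E (flow u) w = (if w = u then sgn_at u else 0) - (if w = root u then 1 else 0)"
proof (induction "depth u" arbitrary: u)
  case 0
  then have "flow u = (\<lambda>e. 0)" by (simp add: flow_root fun_eq_iff)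
  with 0 show ?case by (simp add: vertex_sum_def sgn_at_def root_depth0 cong: if_cong)
next
  case (Suc k)
  then have pos: "0 < depth u" by simp
  have "flow u = (\<lambda>e. (if e = {u, parent u} then sgn_at u else 0) + flow (parent u) e)"
    using flow_parent[OF pos] by (simp add: fun_eq_iff)
  then have "vertex_sum E (flow u) w = (if w \<in> {u, parent u} then sgn_at u else 0)
      + vertex_sum E (flow (parent u)) w"
    by (simp only: vertex_sum_add vertex_sum_single[OF finite_E parent_edge[OF pos]])
  moreover have "vertex_sum E (flow (parent u)) w
      = (if w = parent u then sgn_at (parent u) else 0) - (if w = root u then 1 else 0)"
    using Suc depth_parent[OF pos] root_parent[OF pos] by simp
  moreover have "sgn_at u = - sgn_at (parent u)"
    using depth_parent[OF pos] by (simp add: sgn_at_def)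
  moreover have "u \<noteq> parent u" using depth_parent[OF pos] by auto
  ultimately show ?case by auto
qed

lemma flow_tree:
  assumes "0 < depth v"
  shows "flow u {v, parent v} = sgn_at v * of_bool (v \<in> anc u)"
proof -
  have "flow u {v, parent v} = (\<Sum>z\<in>anc u. if z = v then sgn_at v else 0)"
    unfolding flow_def by (rule sum.cong) (use assms tree_edge_inj in auto)
  then show ?thesis by (simp add: finite_anc)
qed

lemma flow_non_tree: "e \<notin> tree_edges \<Longrightarrow> flow u e = 0"
  unfolding flow_def by (rule sum.neutral) (auto simp: tree_edges_def)

lemma sgn_at_values: "sgn_at v = 1 \<or> sgn_at v = -1"
  by (simp add: sgn_at_def minus_one_power_iff)

text \<open>A chord with ends of opposite sign closes an even cycle, which carries an alternating
  weighting. In \<open>flow a - flow b\<close> the edges above common ancestors and the defects at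
  the shared root cancel; the chord then repairs the sums at \<open>a\<close> and
  \<open>b\<close>.\<close>

lemma chord_same_sign:
  assumes free: "balanced_free E" and e: "{a, b} \<in> E - tree_edges"
    and ab: "a \<noteq> b"
  shows "sgn_at a = sgn_at b"
proof (rule ccontr)
  assume "sgn_at a \<noteq> sgn_at b"
  then have opp: "sgn_at b = - sgn_at a" using sgn_at_values[of a] sgn_at_values[of b] by auto
  define f where "f = (\<lambda>e. flow a e - flow b e - (if e = {a, b} then sgn_at a else 0))"
  have "vertex_sum E f w = 0" for w
    using e ab opp root_edge[of a b]
    by (simp add: f_def vertex_sum_diff vertex_sum_flow vertex_sum_single finite_E)
  moreover have "f e \<in> {-1, 0, 1}" for e
  proof (cases "e \<in> tree_edges")
    case True
    then obtain v where "0 < depth v" "e = {v, parent v}" by (auto simp: tree_edges_def)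
    moreover have "e \<noteq> {a, b}" using True e by auto
    ultimately show ?thesis using sgn_at_values[of v] by (auto simp: f_def flow_tree)
  next
    case False
    then show ?thesis using sgn_at_values[of a] by (auto simp: f_def flow_non_tree)
  qed
  ultimately have "f {a, b} = 0" using free e unfolding balanced_free_def by blast
  then show False using e sgn_at_values[of a] by (simp add: f_def flow_non_tree)
qed

text \<open>
  For an edge \<open>e\<close> this is the vertex set of the path in the forest joining its ends: no tree edge
  separates such a vertex from both ends. Hence if the paths of two chords meet, no tree edge
  separates one chord from the other, which keeps the combined flow within \<open>{-1, 0, 1}\<close>.
\<close>

definition tree_path :: "'a set \<Rightarrow> 'a set" where
  "tree_path e = {u. \<Inter>(anc ` e) \<subseteq> anc u \<and> anc u \<subseteq> \<Union>(anc ` e)}"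

text \<open>Since the ends of a chord have equal signs, \<open>flow a + flow b\<close> minus the
  weighted chord is balanced except for -2 at the root. Subtracting the same expression for the
  second chord removes this defect.\<close>

lemma tree_path_disjoint:
  assumes free: "balanced_free E"
    and e1: "{a, b} \<in> E - tree_edges" "a \<noteq> b"
    and e2: "{c, d} \<in> E - tree_edges" "c \<noteq> d"
    and ne: "{a, b} \<noteq> {c, d}"
  shows "tree_path {a, b} \<inter> tree_path {c, d} = {}"
proof (rule ccontr)
  assume "tree_path {a, b} \<inter> tree_path {c, d} \<noteq> {}"
  then obtain u where u: "anc a \<inter> anc b \<subseteq> anc u" "anc u \<subseteq> anc a \<union> anc b"
    "anc c \<inter> anc d \<subseteq> anc u" "anc u \<subseteq> anc c \<union> anc d"
    unfolding tree_path_def by auto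
  have s: "sgn_at b = sgn_at a" "sgn_at d = sgn_at c"
    using chord_same_sign[OF free] e1 e2 by auto
  \<comment> \<open>The root of \<open>u\<close> is an ancestor of an end of each chord, so all four
    ends lie in one tree and their root defects cancel.\<close>
  have "root u \<in> anc a \<or> root u \<in> anc b" "root u \<in> anc c \<or> root u \<in> anc d"
    using u root_in_anc[of u] by blast+
  then have "root u = root a \<or> root u = root b" "root u = root c \<or> root u = root d"
    using root_anc[OF _ depth_root[of u]] by blast+
  moreover have "root a = root b" "root c = root d" using root_edge e1 e2 by blast+
  ultimately have r: "root a = root u" "root b = root u" "root c = root u" "root d = root u"
    by auto
  define f where "f = (\<lambda>e. flow a e + flow b e - flow c e - flow d e
      - (if e = {a, b} then sgn_at a else 0) + (if e = {c, d} then sgn_at c else 0))"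
  have "vertex_sum E f w = 0" for w
  proof -
    have "(if w \<in> {a, b} then sgn_at a else 0)
        = (if w = a then sgn_at a else 0) + (if w = b then sgn_at a else 0)"
      "(if w \<in> {c, d} then sgn_at c else 0)
        = (if w = c then sgn_at c else 0) + (if w = d then sgn_at c else 0)"
      using e1 e2 by auto
    moreover have "vertex_sum E (\<lambda>e. if e = {a, b} then sgn_at a else 0) w
        = (if w \<in> {a, b} then sgn_at a else 0)"
      "vertex_sum E (\<lambda>e. if e = {c, d} then sgn_at c else 0) w
        = (if w \<in> {c, d} then sgn_at c else 0)"
      using vertex_sum_single[OF finite_E] e1 e2 by auto
    ultimately show ?thesis
      unfolding f_def vertex_sum_add vertex_sum_diff vertex_sum_flow s r by linarith
  qed
  moreover have "f e \<in> {-1, 0, 1}" for e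
  proof (cases "e \<in> tree_edges")
    case True
    then obtain v where "0 < depth v" "e = {v, parent v}" by (auto simp: tree_edges_def)
    moreover have "e \<noteq> {a, b}" "e \<noteq> {c, d}" using True e1 e2 by auto
    ultimately have "f e = sgn_at v * (of_bool (v \<in> anc a) + of_bool (v \<in> anc b)
        - of_bool (v \<in> anc c) - of_bool (v \<in> anc d))"
      by (simp add: f_def flow_tree distrib_left right_diff_distrib)
    \<comment> \<open>This excludes the weights 2 and -2: a common ancestor of the ends of one chord
      is an ancestor of \<open>u\<close>, hence of an end of the other.\<close>
    moreover have "v \<in> anc a \<and> v \<in> anc b \<longrightarrow> v \<in> anc c \<or> v \<in> anc d"
      "v \<in> anc c \<and> v \<in> anc d \<longrightarrow> v \<in> anc a \<or> v \<in> anc b"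
      using u by blast+
    ultimately show ?thesis using sgn_at_values[of v] by (auto simp: of_bool_def)
  next
    case False
    then show ?thesis using ne sgn_at_values[of a] sgn_at_values[of c]
      by (auto simp: f_def flow_non_tree)
  qed
  ultimately have "f {a, b} = 0" using free e1 unfolding balanced_free_def by blast
  then show False using e1 ne sgn_at_values[of a] by (simp add: f_def flow_non_tree)
qed

section \<open>Edge bound for graphs without balanced weightings\<close>

lemma third_vertex_aux:
  assumes e: "{a, b} \<in> E - tree_edges" "a \<notin> anc b"
  shows "\<exists>z\<in>tree_path {a, b}. z \<noteq> a \<and> z \<noteq> b"
proof -
  \<comment> \<open>If \<open>a\<close> were a root it would be the root of \<open>b\<close>, hence
    in \<open>anc b\<close>.\<close>
  have pos: "0 < depth a"
    using e root_edge[of a b] root_depth0[of a] root_in_anc[of b] by (cases "depth a = 0") auto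
  have "parent a \<noteq> a" using depth_parent[OF pos] by auto
  \<comment> \<open>Equality would turn the chord into a tree edge.\<close>
  moreover have "parent a \<noteq> b" using e pos by (auto simp: tree_edges_def)
  moreover have "parent a \<in> tree_path {a, b}"
    using e(2) anc_parent[OF pos] by (auto simp: tree_path_def)
  ultimately show ?thesis by blast
qed

lemma card_tree_path:
  assumes e: "{a, b} \<in> E - tree_edges" "a \<noteq> b" and fin: "finite (tree_path {a, b})"
  shows "3 \<le> card (tree_path {a, b})"
proof -
  have "a \<notin> anc b \<or> b \<notin> anc a" using depth_anc[of a b] depth_anc[of b a] e by auto
  then obtain z where z: "z \<in> tree_path {a, b}" "z \<noteq> a" "z \<noteq> b"
    using third_vertex_aux[of a b] third_vertex_aux[of b a] e by (auto simp: insert_commute)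
  have "{a, b, z} \<subseteq> tree_path {a, b}" using z by (auto simp: tree_path_def)
  from card_mono[OF fin this] show ?thesis using z e by simp
qed

lemma anc_subset:
  assumes "\<And>e. e \<in> E \<Longrightarrow> e \<subseteq> V" "u \<in> V"
  shows "anc u \<subseteq> V"
  using assms(2)
proof (induction "depth u" arbitrary: u)
  case 0
  then show ?case by (simp add: anc_root)
next
  case (Suc k)
  then have "parent u \<in> V" using assms(1)[OF parent_edge[of u]] by simp
  then show ?case using Suc depth_parent[of u] anc_parent[of u] by simp
qed

text \<open>Each non-root vertex gives one tree edge and \<open>V\<close> contains a root, so there
  are at most \<open>card V - 1\<close> tree edges. The chords have disjoint tree paths of at least
  3 vertices each, so at most \<open>card V / 3\<close> chords exist.\<close>

lemma balanced_free_card_aux: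
  assumes free: "balanced_free E" and V: "finite V" "V \<noteq> {}"
    and E: "\<And>e. e \<in> E \<Longrightarrow> e \<subseteq> V \<and> card e = 2"
  shows "3 * card E + 3 \<le> 4 * card V"
proof -
  have sub: "anc u \<subseteq> V" if "u \<in> V" for u using anc_subset[OF _ that] E by blast
  have tree_E: "tree_edges \<subseteq> E" using parent_edge by (auto simp: tree_edges_def)
  from V obtain u where "u \<in> V" by blast
  then have r: "root u \<in> V" using sub root_in_anc by blast
  have "tree_edges \<subseteq> (\<lambda>v. {v, parent v}) ` (V - {root u})"
  proof
    fix e assume "e \<in> tree_edges"
    then obtain v where v: "0 < depth v" "e = {v, parent v}" by (auto simp: tree_edges_def)
    moreover have "v \<in> V" using v E[OF parent_edge[OF v(1)]] by auto
    moreover have "v \<noteq> root u" using v depth_root[of u] by auto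
    ultimately show "e \<in> (\<lambda>v. {v, parent v}) ` (V - {root u})" by auto
  qed
  then have "card tree_edges \<le> card (V - {root u})"
    using V by (meson finite_Diff surj_card_le)
  then have tree: "card tree_edges + 1 \<le> card V"
    using V r card_gt_0_iff[of V] by (auto simp: card_Diff_singleton)
  have chord: "\<exists>a b. e = {a, b} \<and> a \<noteq> b \<and> a \<in> V \<and> b \<in> V" if "e \<in> E" for e
    using E[OF that] by (auto simp: card_2_iff)
  have path_V: "tree_path e \<subseteq> V" if "e \<in> E" for e
    using sub self_in_anc E[OF that] by (fastforce simp: tree_path_def)
  then have fin: "finite (tree_path e)" if "e \<in> E" for e using V that finite_subset by metis
  have "3 * card (E - tree_edges) \<le> (\<Sum>e\<in>E - tree_edges. card (tree_path e))"
  proof -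
    have "3 \<le> card (tree_path e)" if "e \<in> E - tree_edges" for e
      using chord[of e] card_tree_path fin that by blast
    from sum_bounded_below[OF this, of "E - tree_edges"] show ?thesis by (simp add: mult.commute)
  qed
  also have "\<dots> = card (\<Union>e\<in>E - tree_edges. tree_path e)"
  proof (rule card_UN_disjoint[symmetric])
    show "\<forall>e\<in>E - tree_edges. \<forall>e'\<in>E - tree_edges. e \<noteq> e' \<longrightarrow> tree_path e \<inter> tree_path e' = {}"
    proof (intro ballI impI)
      fix e e' assume *: "e \<in> E - tree_edges" "e' \<in> E - tree_edges" "e \<noteq> e'"
      obtain a b where "e = {a, b}" "a \<noteq> b" using chord[of e] * by auto
      moreover obtain c d where "e' = {c, d}" "c \<noteq> d" using chord[of e'] * by auto
      ultimately show "tree_path e \<inter> tree_path e' = {}"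
        using tree_path_disjoint[OF free] * by metis
    qed
  qed (use finite_E fin in auto)
  also have "\<dots> \<le> card V" using path_V V by (intro card_mono) auto
  finally have "3 * card (E - tree_edges) \<le> card V" .
  moreover have "card E = card tree_edges + card (E - tree_edges)"
    using tree_E finite_E by (metis card_Diff_subset card_mono finite_subset le_add_diff_inverse)
  ultimately show ?thesis using tree by linarith
qed

end

text \<open>Breadth-first search from one chosen vertex in each component.\<close>

lemma rooted_forest_exists:
  fixes E :: "'a set set"
  assumes "finite E"
  shows "\<exists>parent root depth. rooted_forest E parent root depth"
proof -
  define R where "R = {(x, y). {x, y} \<in> E}"
  have symR: "sym R" by (auto simp: R_def sym_def insert_commute)
  then have symS: "(x, y) \<in> R\<^sup>* \<longleftrightarrow> (y, x) \<in> R\<^sup>*" for x y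
    by (meson sym_rtrancl symD)
  \<comment> \<open>The choice depends only on the set of vertices reachable from \<open>v\<close>,
    so it is constant on components.\<close>
  define root where "root v = (SOME u. (v, u) \<in> R\<^sup>*)" for v
  have root_conn: "(v, root v) \<in> R\<^sup>*" for v
    unfolding root_def by (rule someI[of _ v]) simp
  have root_eq: "root a = root b" if "(a, b) \<in> R\<^sup>*" for a b
  proof -
    have "(a, u) \<in> R\<^sup>* \<longleftrightarrow> (b, u) \<in> R\<^sup>*" for u
      using that symS by (meson rtrancl_trans)
    then show ?thesis by (simp add: root_def)
  qed
  \<comment> \<open>Distance from the root. The last vertex before \<open>v\<close> on a shortest
    walk has depth one less and serves as parent.\<close>
  define depth where "depth v = (LEAST k. (root v, v) \<in> R ^^ k)" for v
  have depth: "(root v, v) \<in> R ^^ depth v" for v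
  proof -
    have "(root v, v) \<in> R\<^sup>*" using root_conn symS by blast
    then obtain k where "(root v, v) \<in> R ^^ k" using rtrancl_imp_relpow by blast
    then show ?thesis unfolding depth_def by (rule LeastI)
  qed
  have depth_le: "depth v \<le> k" if "(root v, v) \<in> R ^^ k" for v k
    unfolding depth_def using that by (rule Least_le)
  have "\<exists>u. 0 < depth v \<longrightarrow> (u, v) \<in> R \<and> depth v = Suc (depth u)" for v
  proof (cases "depth v")
    case (Suc k)
    then obtain u where u: "(root v, u) \<in> R ^^ k" "(u, v) \<in> R"
      using depth[of v] by auto
    then have r: "root u = root v" using root_eq by blast
    have "depth u \<le> k" using u r depth_le by simp
    moreover have "(root v, v) \<in> R ^^ Suc (depth u)" using depth[of u] u r by auto
    then have "depth v \<le> Suc (depth u)" by (rule depth_le)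
    ultimately show ?thesis using u Suc by (intro exI[of _ u]) auto
  qed auto
  then obtain parent where parent:
    "\<And>v. 0 < depth v \<Longrightarrow> (parent v, v) \<in> R \<and> depth v = Suc (depth (parent v))"
    by metis
  have "rooted_forest E parent root depth"
  proof
    show "root v = v" if "depth v = 0" for v using depth[of v] that by simp
    show "root (parent v) = root v" if "0 < depth v" for v
      using parent[OF that] root_eq by blast
    show "root a = root b" if "{a, b} \<in> E" for a b using that root_eq by (auto simp: R_def)
    show "depth v = Suc (depth (parent v))" if "0 < depth v" for v
      using parent[OF that] by blast
    show "{v, parent v} \<in> E" if "0 < depth v" for v
      using parent[OF that] by (simp add: R_def insert_commute)
  qed (rule assms)
  then show ?thesis by blast
qed

lemma balanced_free_card:
  assumes "balanced_free E" "finite V" "V \<noteq> {}" "\<And>e. e \<in> E \<Longrightarrow> e \<subseteq> V \<and> card e = 2"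
  shows "3 * card E + 3 \<le> 4 * card V"
proof -
  have "E \<subseteq> Pow V" using assms(4) by blast
  then have "finite E" using assms(2) finite_subset by blast
  then obtain parent root depth where "rooted_forest E parent root depth"
    using rooted_forest_exists by blast
  then show ?thesis using rooted_forest.balanced_free_card_aux assms by blast
qed

section \<open>Link graphs and trades in the full design\<close>

definition link :: "nat set set \<Rightarrow> nat \<Rightarrow> nat set set" where
  "link U x = {e. card e = 2 \<and> x \<notin> e \<and> insert x e \<in> U}"

lemma mem_link: "e \<in> link U x \<longleftrightarrow> card e = 2 \<and> x \<notin> e \<and> insert x e \<in> U"
  by (simp add: link_def)

lemma finite_full_design: "finite (full_design v k)"
  by (rule finite_subset[of _ "Pow {1..v}"]) (auto simp: full_design_def)

text \<open>Exchanging \<open>T1\<close> for \<open>T2\<close> keeps all pair counts and all of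
  \<open>D\<close>, so it must give back the full design, although blocks of \<open>T1\<close> are
  gone. \<open>T2\<close> may meet \<open>D\<close>, since designs may repeat blocks.\<close>

lemma defining_set_no_trade:
  assumes D: "defining_set v k D"
    and T1: "T1 \<subseteq> full_design v k - D" and T2: "T2 \<subseteq> full_design v k"
    and disj: "T1 \<inter> T2 = {}"
    and trade: "\<And>p q. p \<noteq> q \<Longrightarrow> card {b \<in> T1. p \<in> b \<and> q \<in> b} = card {b \<in> T2. p \<in> b \<and> q \<in> b}"
  shows "T1 = {}"
proof -
  let ?F = "full_design v k" and ?l = "(v - 2) choose (k - 2)"
  define B where "B = mset_set (?F - T1) + mset_set T2"
  have fin: "finite ?F" "finite T1" "finite T2"
    using finite_full_design T1 T2 by (auto intro: finite_subset)
  have D_sub: "D \<subseteq> ?F"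
    and uniq: "{B. is_design v k ?l B \<and> mset_set D \<subseteq># B} = {mset_set ?F}"
    using D by (auto simp: defining_set_def)
  then have F: "is_design v k ?l (mset_set ?F)" by blast
  have "is_design v k ?l B"
    unfolding is_design_def
  proof (intro conjI ballI impI)
    fix b assume "b \<in># B"
    then have "b \<in> ?F" using fin T2 by (auto simp: B_def)
    then show "b \<subseteq> {1..v}" "card b = k" by (auto simp: full_design_def)
  next
    fix x y assume xy: "x \<in> {1..v}" "y \<in> {1..v}" "x \<noteq> y"
    let ?c = "\<lambda>A. {b \<in> A. x \<in> b \<and> y \<in> b}"
    have "size {#b \<in># B. x \<in> b \<and> y \<in> b#} = card (?c (?F - T1)) + card (?c T2)"
      using fin by (simp add: B_def filter_mset_mset_set)
    also have "\<dots> = card (?c (?F - T1)) + card (?c T1)" using trade xy by simp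
    also have "\<dots> = card (?c (?F - T1) \<union> ?c T1)"
      using fin by (intro card_Un_disjoint[symmetric]) auto
    also have "?c (?F - T1) \<union> ?c T1 = ?c ?F" using T1 by auto
    also have "card (?c ?F) = ?l"
      using F xy fin by (simp add: is_design_def filter_mset_mset_set)
    finally show "size {#b \<in># B. x \<in> b \<and> y \<in> b#} = ?l" .
  qed
  moreover have "mset_set D \<subseteq># B"
  proof -
    have "mset_set D \<subseteq># mset_set (?F - T1)"
      using D_sub T1 fin by (intro subset_imp_msubset_mset_set) auto
    then show ?thesis by (simp add: B_def subset_mset.add_increasing2)
  qed
  ultimately have B: "B = mset_set ?F" using uniq by blast
  show ?thesis
  proof (rule ccontr)
    assume "T1 \<noteq> {}"
    then obtain b where "b \<in> T1" by blast
    then have "count B b = 0" "count (mset_set ?F) b = 1"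
      using disj T1 fin by (auto simp: B_def count_mset_set')
    then show False using B by simp
  qed
qed

lemma card_insert_image:
  assumes "\<And>e. e \<in> A \<Longrightarrow> z \<notin> e"
  shows "card {b \<in> insert z ` A. Q b} = card {e \<in> A. Q (insert z e)}"
proof -
  have "{b \<in> insert z ` A. Q b} = insert z ` {e \<in> A. Q (insert z e)}" by blast
  moreover have "inj_on (insert z) {e \<in> A. Q (insert z e)}"
    using assms by (intro inj_onI) (metis (no_types, lifting) insert_ident mem_Collect_eq)
  ultimately show ?thesis by (simp add: card_image)
qed

lemma vertex_sum_zero_card:
  assumes "finite E" "\<And>e. e \<in> E \<Longrightarrow> f e \<in> {-1, 0, 1}" "vertex_sum E f w = 0"
  shows "card {e \<in> E. f e = 1 \<and> w \<in> e} = card {e \<in> E. f e = -1 \<and> w \<in> e}"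
proof -
  have "vertex_sum E f w = (\<Sum>e\<in>E. (if f e = 1 \<and> w \<in> e then 1 else 0))
      - (\<Sum>e\<in>E. (if f e = -1 \<and> w \<in> e then 1 else 0))"
    unfolding vertex_sum_def sum_subtractf[symmetric]
    by (rule sum.cong) (use assms(2) in auto)
  then show ?thesis using assms(1,3) by (simp flip: sum.inter_filter)
qed

text \<open>The trade replaces \<open>T x y\<close> by \<open>T y x\<close>. Pairs avoiding
  \<open>x\<close> and \<open>y\<close> keep their counts, the pair of \<open>x\<close> and
  \<open>y\<close> is never covered, and for a pair of \<open>x\<close> or \<open>y\<close> with
  another point \<open>w\<close> the counts agree because \<open>P\<close> and \<open>M\<close> have
  equal degree at \<open>w\<close>.\<close>

lemma common_link_balanced_free:
  assumes D: "defining_set v 3 D" and xy: "x \<noteq> y"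
  defines "U \<equiv> full_design v 3 - D"
  shows "balanced_free (link U x \<inter> link U y)"
  unfolding balanced_free_def
proof (intro allI impI)
  fix f :: "nat set \<Rightarrow> int"
  let ?E = "link U x \<inter> link U y"
  assume f: "\<forall>e\<in>?E. f e \<in> {-1, 0, 1}" and bal: "\<forall>w. vertex_sum ?E f w = 0"
  define P where "P = {e \<in> ?E. f e = 1}"
  define M where "M = {e \<in> ?E. f e = -1}"
  have "?E \<subseteq> Pow {1..v}" unfolding link_def U_def full_design_def by blast
  then have fin: "finite ?E" using finite_subset by blast
  then have finPM: "finite P" "finite M"
    by (auto simp: P_def M_def intro: rev_finite_subset[OF fin])
  have notin: "x \<notin> e" "y \<notin> e" if "e \<in> P \<or> e \<in> M" for e
    using that by (auto simp: P_def M_def mem_link)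
  have inU: "insert x e \<in> U" "insert y e \<in> U" if "e \<in> P \<or> e \<in> M" for e
    using that by (auto simp: P_def M_def mem_link)
  have PM: "P \<inter> M = {}" by (auto simp: P_def M_def)
  define T where "T = (\<lambda>a b. insert a ` P \<union> insert b ` M)"
  \<comment> \<open>Distinct \<open>a\<close> and \<open>b\<close> serve for counting within one
    side of the trade, equal ones for the disjointness of the two sides.\<close>
  have disj: "insert a ` P \<inter> insert b ` M = {}" if "a \<in> {x, y}" "b \<in> {x, y}" for a b
  proof -
    have "insert a e \<noteq> insert b e'" if "e \<in> P" "e' \<in> M" for e e'
    proof
      assume eq: "insert a e = insert b e'"
      have "a \<notin> e" "a \<notin> e'" "b \<notin> e" "b \<notin> e'"
        using notin \<open>a \<in> {x, y}\<close> \<open>b \<in> {x, y}\<close> that by auto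
      then have "e = e'" using eq by (metis insert_ident insert_iff)
      then show False using PM that by blast
    qed
    then show ?thesis by blast
  qed
  have count: "card {b \<in> T a c. Q b}
      = card {e \<in> P. Q (insert a e)} + card {e \<in> M. Q (insert c e)}"
    if "a \<in> {x, y}" "c \<in> {x, y}" for a c Q
  proof -
    have "{b \<in> T a c. Q b} = {b \<in> insert a ` P. Q b} \<union> {b \<in> insert c ` M. Q b}"
      by (auto simp: T_def)
    moreover have "card ({b \<in> insert a ` P. Q b} \<union> {b \<in> insert c ` M. Q b})
      = card {b \<in> insert a ` P. Q b} + card {b \<in> insert c ` M. Q b}"
      using finPM disj[OF that] by (intro card_Un_disjoint) auto
    moreover have "a \<notin> e" if "e \<in> P" for e using notin[of e] \<open>a \<in> {x, y}\<close> that by auto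
    moreover have "c \<notin> e" if "e \<in> M" for e using notin[of e] \<open>c \<in> {x, y}\<close> that by auto
    ultimately show ?thesis by (simp add: card_insert_image)
  qed
  have deg: "card {e \<in> P. w \<in> e} = card {e \<in> M. w \<in> e}" for w
    using vertex_sum_zero_card[OF fin, of f w] f bal
    by (simp add: P_def M_def conj_assoc)
  have "T x y = {}"
  proof (rule defining_set_no_trade[OF D, of _ "T y x"])
    show "T x y \<subseteq> full_design v 3 - D" "T y x \<subseteq> full_design v 3"
      using inU by (auto simp: T_def U_def)
    show "T x y \<inter> T y x = {}"
    proof -
      have "insert x e \<noteq> insert y e'" if "e \<in> P \<or> e \<in> M" for e e'
        using notin[OF that] xy by (metis insert_iff)
      then have "insert x ` A \<inter> insert y ` B = {}" if "A = P \<or> A = M" for A B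
        using that by blast
      from this[of P P] this[of M M] show ?thesis
        using disj[of x x] disj[of y y]
        by (simp add: T_def Int_Un_distrib Int_Un_distrib2 Int_commute)
    qed
    fix p q :: nat assume pq: "p \<noteq> q"
    define K where "K z A = card {e \<in> A. p \<in> insert z e \<and> q \<in> insert z e}" for z A
    have c: "card {b \<in> T x y. p \<in> b \<and> q \<in> b} = K x P + K y M"
      "card {b \<in> T y x. p \<in> b \<and> q \<in> b} = K y P + K x M"
      using count[of x y "\<lambda>b. p \<in> b \<and> q \<in> b"] count[of y x "\<lambda>b. p \<in> b \<and> q \<in> b"]
      unfolding K_def by simp_all
    consider "p \<in> {x, y}" "q \<in> {x, y}" | "p \<in> {x, y}" "q \<notin> {x, y}"
      | "p \<notin> {x, y}" "q \<in> {x, y}" | "p \<notin> {x, y}" "q \<notin> {x, y}" by blast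
    then show "card {b \<in> T x y. p \<in> b \<and> q \<in> b} = card {b \<in> T y x. p \<in> b \<and> q \<in> b}"
    proof cases
      case 1
      have "K z A = 0" if "A = P \<or> A = M" for A z
      proof -
        have "p \<notin> e" "q \<notin> e" if "e \<in> A" for e
          using notin[of e] that 1 \<open>A = P \<or> A = M\<close> by blast+
        then have "{e \<in> A. p \<in> insert z e \<and> q \<in> insert z e} = {}" using pq by blast
        then show ?thesis by (simp only: K_def card.empty)
      qed
      then show ?thesis unfolding c by simp
    next
      case 2
      have "K z A = (if p = z then card {e \<in> A. q \<in> e} else 0)"
        if "A = P \<or> A = M" "z = x \<or> z = y" for A z
      proof -
        have "p \<notin> e" if "e \<in> A" for e using notin[of e] that 2 \<open>A = P \<or> A = M\<close> by blast
        then have "{e \<in> A. p \<in> insert z e \<and> q \<in> insert z e} = (if p = z then {e \<in> A. q \<in> e} else {})"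
          using 2 that by auto
        then show ?thesis by (simp only: K_def card.empty split: if_split) simp
      qed
      then show ?thesis unfolding c using 2 xy deg[of q] by auto
    next
      case 3
      have "K z A = (if q = z then card {e \<in> A. p \<in> e} else 0)"
        if "A = P \<or> A = M" "z = x \<or> z = y" for A z
      proof -
        have "q \<notin> e" if "e \<in> A" for e using notin[of e] that 3 \<open>A = P \<or> A = M\<close> by blast
        then have "{e \<in> A. p \<in> insert z e \<and> q \<in> insert z e} = (if q = z then {e \<in> A. p \<in> e} else {})"
          using 3 that by auto
        then show ?thesis by (simp only: K_def card.empty split: if_split) simp
      qed
      then show ?thesis unfolding c using 3 xy deg[of p] by auto
    next
      case 4
      then have "K x A = K y A" for A by (simp add: K_def)
      then show ?thesis unfolding c by simp
    qed
  qed
  then show "\<forall>e\<in>?E. f e = 0" using f by (auto simp: T_def P_def M_def)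
qed

lemma card_common_link:
  assumes D: "defining_set v 3 D" and v: "3 \<le> v"
    and xy: "x \<in> {1..v}" "y \<in> {1..v}" "x \<noteq> y"
  defines "U \<equiv> full_design v 3 - D"
  shows "real (card (link U x \<inter> link U y)) \<le> (4 * real v - 11) / 3"
proof -
  have c: "card ({1..v} - {x, y}) = v - 2" using xy by (simp add: card_Diff_subset)
  have "3 * card (link U x \<inter> link U y) + 3 \<le> 4 * card ({1..v} - {x, y})"
  proof (rule balanced_free_card)
    show "balanced_free (link U x \<inter> link U y)"
      unfolding U_def by (rule common_link_balanced_free[OF D xy(3)])
    show "{1..v} - {x, y} \<noteq> {}" using c v by (metis card.empty diff_is_0_eq not_less_eq_eq numeral_2_eq_2 numeral_3_eq_3)
    show "e \<subseteq> {1..v} - {x, y} \<and> card e = 2" if "e \<in> link U x \<inter> link U y" for e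
      using that unfolding link_def U_def full_design_def by blast
  qed simp
  \<comment> \<open>Here \<open>4 * (v - 2) - 3 = 4 * v - 11\<close>; \<open>3 \<le> v\<close> makes
    the truncated difference exact.\<close>
  then have "3 * card (link U x \<inter> link U y) + 11 \<le> 4 * v" using c v by linarith
  then have "real (3 * card (link U x \<inter> link U y) + 11) \<le> real (4 * v)" by (rule of_nat_mono)
  then show ?thesis by simp
qed

section \<open>Moments of the pair degrees\<close>

definition codeg :: "nat set set \<Rightarrow> nat set \<Rightarrow> nat" where
  "codeg U e = card {x. x \<notin> e \<and> insert x e \<in> U}"

text \<open>Double counting of blocks with a marked point: removing the point leaves a pair, and
  each block has three choices.\<close>

lemma sum_codeg:
  assumes "U \<subseteq> full_design v 3"
  shows "(\<Sum>e\<in>full_design v 2. codeg U e) = 3 * card U"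
proof -
  let ?S = "SIGMA e:full_design v 2. {x. x \<notin> e \<and> insert x e \<in> U}" and ?T = "SIGMA b:U. b"
  have card_U: "card b = 3" "b \<subseteq> {1..v}" if "b \<in> U" for b
    using assms that by (auto simp: full_design_def)
  then have fin_b: "finite b" if "b \<in> U" for b using that by (metis card.infinite zero_neq_numeral)
  have finU: "finite U" using assms finite_full_design finite_subset by blast
  have "{x. x \<notin> e \<and> insert x e \<in> U} \<subseteq> {1..v}" for e using card_U by blast
  then have ext: "finite {x. x \<notin> e \<and> insert x e \<in> U}" for e
    by (rule finite_subset) simp
  have "bij_betw (\<lambda>(e, x). (insert x e, x)) ?S ?T"
  proof (rule bij_betw_byWitness[where f' = "\<lambda>(b, x). (b - {x}, x)"])
    show "(\<lambda>(b, x). (b - {x}, x)) ` ?T \<subseteq> ?S"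
      using card_U fin_b by (fastforce simp: full_design_def insert_absorb)
  qed (auto simp: insert_absorb)
  then have "card ?S = card ?T" by (rule bij_betw_same_card)
  moreover have "card ?S = (\<Sum>e\<in>full_design v 2. codeg U e)"
    unfolding codeg_def using finite_full_design ext
    by (intro card_SigmaI) auto
  moreover have "card ?T = (\<Sum>b\<in>U. card b)" using finU fin_b by (intro card_SigmaI) auto
  ultimately show ?thesis using card_U by simp
qed

lemma codeg_link:
  assumes "U \<subseteq> full_design v 3" "e \<in> full_design v 2"
  shows "real (codeg U e) = (\<Sum>x=1..v. of_bool (e \<in> link U x))"
proof -
  have "{x. x \<notin> e \<and> insert x e \<in> U} = {x\<in>{1..v}. e \<in> link U x}"
    using assms by (auto simp: mem_link full_design_def)
  then show ?thesis by (simp add: codeg_def of_bool_def flip: sum.inter_filter)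
qed

lemma card_links:
  assumes "U \<subseteq> full_design v 3" "A \<subseteq> link U x"
  shows "real (card A) = (\<Sum>e\<in>full_design v 2. of_bool (e \<in> A))"
proof -
  have "A = {e \<in> full_design v 2. e \<in> A}"
    using assms by (fastforce simp: mem_link full_design_def)
  then have "real (card A) = real (card {e \<in> full_design v 2. e \<in> A})" by simp
  then show ?thesis using finite_full_design by (simp add: of_bool_def flip: sum.inter_filter)
qed

text \<open>The square counts ordered pairs of points \<open>x\<close>, \<open>y\<close>, possibly
  equal, that both complete \<open>e\<close> to a block of \<open>U\<close>; summing over
  \<open>e\<close> first yields common links.\<close>

lemma sum_codeg_square:
  assumes U: "U \<subseteq> full_design v 3"
  shows "(\<Sum>e\<in>full_design v 2. (real (codeg U e))\<^sup>2)
    = (\<Sum>x=1..v. \<Sum>y=1..v. real (card (link U x \<inter> link U y)))"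
proof -
  have "(\<Sum>x=1..v. \<Sum>y=1..v. real (card (link U x \<inter> link U y)))
      = (\<Sum>x=1..v. \<Sum>y=1..v. \<Sum>e\<in>full_design v 2. of_bool (e \<in> link U x) * of_bool (e \<in> link U y))"
    using card_links[OF U, of "link U x \<inter> link U y" x for x y] by (simp add: of_bool_conj)
  also have "\<dots> = (\<Sum>x=1..v. \<Sum>e\<in>full_design v 2. \<Sum>y=1..v. of_bool (e \<in> link U x) * of_bool (e \<in> link U y))"
    by (intro sum.cong refl sum.swap)
  also have "\<dots> = (\<Sum>e\<in>full_design v 2. \<Sum>x=1..v. \<Sum>y=1..v. of_bool (e \<in> link U x) * of_bool (e \<in> link U y))"
    by (rule sum.swap)
  also have "\<dots> = (\<Sum>e\<in>full_design v 2. (real (codeg U e))\<^sup>2)"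
    by (intro sum.cong refl) (simp only: codeg_link[OF U] power2_eq_square sum_product)
  finally show ?thesis by simp
qed

lemma sum_card_link:
  assumes U: "U \<subseteq> full_design v 3"
  shows "(\<Sum>x=1..v. real (card (link U x))) = 3 * real (card U)"
proof -
  have "(\<Sum>x=1..v. real (card (link U x)))
      = (\<Sum>x=1..v. \<Sum>e\<in>full_design v 2. of_bool (e \<in> link U x))"
    by (intro sum.cong refl card_links[OF U]) auto
  also have "\<dots> = (\<Sum>e\<in>full_design v 2. \<Sum>x=1..v. of_bool (e \<in> link U x))"
    by (rule sum.swap)
  also have "\<dots> = (\<Sum>e\<in>full_design v 2. real (codeg U e))"
    by (intro sum.cong refl) (simp only: codeg_link[OF U])
  also have "\<dots> = 3 * real (card U)"
    using sum_codeg[OF U] by (metis of_nat_mult of_nat_numeral of_nat_sum)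
  finally show ?thesis .
qed

section \<open>Cauchy-Schwarz bound and asymptotics\<close>

lemma card_full_design: "card (full_design v k) = v choose k"
  by (simp add: full_design_def n_subsets)

lemma choose_3: "real (v choose 3) = real v * (real v - 1) * (real v - 2) / 6"
  by (simp add: binomial_gbinomial gbinomial_prod_rev numeral_3_eq_3 fact_reduce algebra_simps)

lemma choose_2_real: "real (v choose 2) = real v * (real v - 1) / 2"
  by (simp add: binomial_gbinomial gbinomial_prod_rev numeral_2_eq_2 algebra_simps)

lemma card_defining_set_ge:
  assumes v: "3 \<le> v" and D: "defining_set v 3 D"
  shows "real (card D) \<ge>
    real v * (real v - 1) * (real v - 5/2 - sqrt ((32 * real v - 85) / 12)) / 6"
proof -
  define U where "U = full_design v 3 - D"
  have U: "U \<subseteq> full_design v 3" by (auto simp: U_def)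
  define N where "N = real v * (real v - 1) / 2"
  let ?S = "3 * real (card U)"
  let ?Q = "\<Sum>e\<in>full_design v 2. (real (codeg U e))\<^sup>2"
  have N: "N > 0" using v by (simp add: N_def)
  have "(\<Sum>e\<in>full_design v 2. real (codeg U e))\<^sup>2 \<le> ?Q * real (card (full_design v 2))"
    by (rule sum_squared_le_sum_of_squares)
  moreover have "(\<Sum>e\<in>full_design v 2. real (codeg U e)) = ?S"
    using sum_codeg[OF U] by (metis of_nat_mult of_nat_numeral of_nat_sum)
  ultimately have CS: "?S\<^sup>2 \<le> N * ?Q" by (simp add: card_full_design choose_2_real N_def mult.commute)
  \<comment> \<open>The diagonal terms \<open>y = x\<close> are full links, for which only the total
    \<open>3 * card U\<close> is used; the \<open>v - 1\<close> others obey the common link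
    bound.\<close>
  have "?Q \<le> (\<Sum>x=1..v. real (card (link U x)) + (real v - 1) * ((4 * real v - 11) / 3))"
    unfolding sum_codeg_square[OF U]
  proof (rule sum_mono)
    fix x assume x: "x \<in> {1..v}"
    have "(\<Sum>y=1..v. real (card (link U x \<inter> link U y)))
        = real (card (link U x)) + (\<Sum>y\<in>{1..v} - {x}. real (card (link U x \<inter> link U y)))"
      using x by (subst sum.remove[of _ x]) auto
    also have "(\<Sum>y\<in>{1..v} - {x}. real (card (link U x \<inter> link U y)))
        \<le> real (card ({1..v} - {x})) * ((4 * real v - 11) / 3)"
      using card_common_link[OF D v x] unfolding U_def by (intro sum_bounded_above) auto
    also have "real (card ({1..v} - {x})) = real v - 1" using x v by (simp add: of_nat_diff)
    finally show "(\<Sum>y=1..v. real (card (link U x \<inter> link U y)))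
        \<le> real (card (link U x)) + (real v - 1) * ((4 * real v - 11) / 3)" by simp
  qed
  \<comment> \<open>Uses \<open>v * (v - 1) = 2 * N\<close>.\<close>
  also have "\<dots> = ?S + N * ((8 * real v - 22) / 3)"
    unfolding sum.distrib sum_card_link[OF U] by (simp add: N_def field_simps)
  finally have Q: "?Q \<le> ?S + N * ((8 * real v - 22) / 3)" .
  \<comment> \<open>The average pair degree of \<open>U\<close>; dividing by
    \<open>N\<^sup>2\<close> turns both estimates into a quadratic inequality in
    \<open>m\<close>.\<close>
  define m where "m = ?S / N"
  have "s = s / n * n" if "0 < n" for s n :: real using that by simp
  from this[OF N] have S: "?S = m * N" unfolding m_def .
  have "N\<^sup>2 * m\<^sup>2 \<le> N * (m * N + N * ((8 * real v - 22) / 3))"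
    using CS mult_left_mono[OF Q, of N] N unfolding S by (simp only: power_mult_distrib) argo
  also have "\<dots> = N\<^sup>2 * (m + (8 * real v - 22) / 3)" by (simp add: power2_eq_square algebra_simps)
  finally have "m\<^sup>2 \<le> m + (8 * real v - 22) / 3" using N by (simp only: mult_le_cancel_left_pos zero_less_power)
  \<comment> \<open>Completing the square:
    \<open>(8 * v - 22) / 3 + 1/4 = (32 * v - 85) / 12\<close>.\<close>
  then have "(m - 1/2)\<^sup>2 \<le> (32 * real v - 85) / 12" by (simp add: power2_diff power2_eq_square field_simps)
  then have "m - 1/2 \<le> sqrt ((32 * real v - 85) / 12)" by (rule real_le_rsqrt)
  then have "N * m \<le> N * (1/2 + sqrt ((32 * real v - 85) / 12))"
    using N by (intro mult_left_mono) auto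
  moreover have "real (card U) = real (v choose 3) - real (card D)"
  proof -
    have "D \<subseteq> full_design v 3" using D by (simp add: defining_set_def)
    then have "card (full_design v 3) = card U + card D"
      unfolding U_def using finite_full_design
      by (metis card_Diff_subset card_mono finite_subset le_add_diff_inverse2)
    then show ?thesis by (simp add: card_full_design)
  qed
  \<comment> \<open>As \<open>3 * card U = N * m\<close>, subtracting from \<open>v choose 3\<close>
    combines \<open>v - 2\<close> and \<open>1/2\<close> into \<open>v - 5/2\<close>.\<close>
  ultimately show ?thesis using S by (simp add: N_def choose_3 field_simps)
qed

theorem theorem3p3:
  "(\<forall>(v::nat) D. 3 \<le> v \<longrightarrow> defining_set v 3 D \<longrightarrow>
      real (card D) \<ge>
        real v * (real v - 1) * (real v - 5/2 - sqrt ((32 * real v - 85) / 12)) / 6)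
   \<and> (\<exists>e \<in> O(\<lambda>v::nat. real v powr (- 1/2)). \<forall>v::nat. 3 \<le> v \<longrightarrow>
      real v * (real v - 1) * (real v - 5/2 - sqrt ((32 * real v - 85) / 12)) / 6
        = real (v choose 3) * (1 - e v))"
proof (intro conjI allI impI)
  \<comment> \<open>Obtained by dividing the bound by \<open>v choose 3\<close>, that is,
    \<open>v - 5/2 - sqrt ...\<close> by \<open>v - 2\<close>; it is of order
    \<open>sqrt v / v\<close>.\<close>
  let ?e = "\<lambda>v::nat. (1/2 + sqrt ((32 * real v - 85) / 12)) / (real v - 2)"
  show "\<exists>e \<in> O(\<lambda>v::nat. real v powr (- 1/2)). \<forall>v::nat. 3 \<le> v \<longrightarrow>
      real v * (real v - 1) * (real v - 5/2 - sqrt ((32 * real v - 85) / 12)) / 6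
        = real (v choose 3) * (1 - e v)"
  proof (intro bexI[of _ ?e] allI impI)
    fix v :: nat assume "3 \<le> v"
    then show "real v * (real v - 1) * (real v - 5/2 - sqrt ((32 * real v - 85) / 12)) / 6
        = real (v choose 3) * (1 - ?e v)"
      by (simp add: choose_3 field_simps)
  next
    show "?e \<in> O(\<lambda>v. real v powr (- 1/2))" by real_asymp
  qed
qed (rule card_defining_set_ge)

end
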